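(* Let $a,b,c>0$ be real numbers with $a^2+b^2=c^2$, and put $$r_1=\tfrac12(a+b-c),\quad r_2=\tfrac12(a-b+c),\quad r_3=\tfrac12(-a+b+c),\quad r_4=\tfrac12(a+b+c).$$ Let $C=(0,0)$, $B=(a,0)$, $A=(0,b)$, $D=(a,b)$, and let $\alpha$ be the system of four pairwise tangent circles $K_1,K_2,K_3,K_4$, where $K_1$ has center $C$ and radius $r_1$, $K_2$ has center $B$ and radius $r_2$, $K_3$ has center $A$ and radius $r_3$, and $K_4$ has center $D$ and radius $r_4$. Let $\rho:(x,y)\mapsto(r_1-y,\,r_1-x)$ be the reflection in the line $\lambda: x+y=r_1$, and let $\beta=\{\rho(K_1),\rho(K_2),\rho(K_3),\rho(K_4)\}$. Then the systems $\alpha$ and $\beta$ (congruent by the reflection $\rho$) are Beecroft duals of each other, and they satisfy: 1. Four of the six tangency points of $\alpha$ lie on the line of reflection $\lambda$. 2. The other two tangency points are symmetric to each other with respect to $\lambda$. 3. The systems $\alpha$ and $\beta$ share all six tangency points. 4. Each circle of $\beta$ is orthogonal to three circles of $\alpha$.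
   Context: Circles are in the Euclidean plane; tangency may be external or internal (the circle $K_4$ encloses the other three). The tangency points of a system of pairwise tangent circles are the contact points of the pairs of circles in the system; here there are six of them. The Beecroft dual of a system of four pairwise tangent circles with six distinct tangency points is the system of four circles obtained by taking, for each choice of three circles of the given system, the circle through the three contact points of those three circles (this circle is orthogonal to those three circles). *)

theory Defs
  imports "HOL-Analysis.Analysis"
begin

text \<open>The Euclidean plane is \<^typ>\<open>real \<times> real\<close>, whose product metric and inner product are the
  Euclidean ones. Circles are point sets, and a system of circles is a set of circles.\<close>

type_synonym point = "real \<times> real"

definition is_circle :: "point set \<Rightarrow> bool" where
  "is_circle S \<longleftrightarrow> (\<exists>z r. r > 0 \<and> S = sphere z r)"

text \<open>For circles, this covers external and internal tangency; a circle is not tangent to itself.\<close>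

definition tangent_circles :: "point set \<Rightarrow> point set \<Rightarrow> bool" where
  "tangent_circles S T \<longleftrightarrow> is_circle S \<and> is_circle T \<and> (\<exists>p. S \<inter> T = {p})"

definition tangency_points :: "point set set \<Rightarrow> point set" where
  "tangency_points \<Omega> = {p. \<exists>S\<in>\<Omega>. \<exists>T\<in>\<Omega>. tangent_circles S T \<and> S \<inter> T = {p}}"

definition four_tangent_circles :: "point set set \<Rightarrow> bool" where
  "four_tangent_circles \<Omega> \<longleftrightarrow>
     card \<Omega> = 4 \<and> (\<forall>S\<in>\<Omega>. is_circle S) \<and> pairwise tangent_circles \<Omega>"

text \<open>The line tangent at \<open>p\<close> to the circle with centre \<open>z\<close> through \<open>p\<close>.\<close>

definition tangent_line :: "point \<Rightarrow> point \<Rightarrow> point set" where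
  "tangent_line z p = {q. orthogonal (q - p) (p - z)}"

definition orthogonal_circles :: "point set \<Rightarrow> point set \<Rightarrow> bool" where
  "orthogonal_circles S T \<longleftrightarrow>
     (\<exists>z r w s. r > 0 \<and> s > 0 \<and> S = sphere z r \<and> T = sphere w s \<and> S \<inter> T \<noteq> {} \<and>
        (\<forall>p\<in>S \<inter> T. \<forall>u\<in>tangent_line z p. \<forall>v\<in>tangent_line w p. orthogonal (u - p) (v - p)))"

text \<open>\<open>is_beecroft_dual \<beta> \<alpha>\<close>: the system \<open>\<beta>\<close> is the Beecroft dual of \<open>\<alpha>\<close>. The circle through the three
  contact points of a triple must exist (they could be collinear for some systems); it is then
  unique, so \<open>\<beta>\<close> is determined by \<open>\<alpha>\<close>.\<close>

definition is_beecroft_dual :: "point set set \<Rightarrow> point set set \<Rightarrow> bool" where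
  "is_beecroft_dual \<beta> \<alpha> \<longleftrightarrow>
     four_tangent_circles \<alpha> \<and> card (tangency_points \<alpha>) = 6 \<and>
     (\<exists>f. bij_betw f {T. T \<subseteq> \<alpha> \<and> card T = 3} \<beta> \<and>
          (\<forall>T. T \<subseteq> \<alpha> \<and> card T = 3 \<longrightarrow> is_circle (f T) \<and> tangency_points T \<subseteq> f T))"

text \<open>For distinct points, symmetry means that \<open>l\<close> is the perpendicular bisector of the segment
  joining them.\<close>

definition symmetric_wrt :: "point set \<Rightarrow> point \<Rightarrow> point \<Rightarrow> bool" where
  "symmetric_wrt l p q \<longleftrightarrow>
     (if p = q then p \<in> l else l = {x. dist x p = dist x q})"

definition is_reflection_in :: "(point \<Rightarrow> point) \<Rightarrow> point set \<Rightarrow> bool" where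
  "is_reflection_in \<rho> l \<longleftrightarrow> (\<forall>p. symmetric_wrt l p (\<rho> p))"

end

theory Submission
  imports Defs
begin

text \<open>In terms of the radii, \<open>a = r1 + r2\<close>, \<open>b = r1 + r3\<close>, \<open>c = r2 + r3\<close>, \<open>r4 = r1 + r2 + r3\<close>, and the
  Pythagorean relation becomes \<open>r1 * r4 = r2 * r3\<close>. The contact points of the four pairs of circles
  whose centres span a side of the rectangle \<open>CBDA\<close> lie on \<open>\<Lambda>\<close>, and \<open>\<rho>\<close> exchanges the two contact
  points belonging to its diagonals. The mirror image of the \<open>i\<close>-th circle passes through the contact
  points of the three circles other than the \<open>(5 - i)\<close>-th, and it is orthogonal to exactly these
  three. As \<open>\<rho>\<close> is an involution, the duality can be read in both directions.\<close>

section \<open>Spheres in coordinates: single contact points, centre and radius\<close>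

lemma mem_sphere_pair_iff:
  fixes u v p q s :: real
  assumes "s \<ge> 0"
  shows "(u, v) \<in> sphere (p, q) s \<longleftrightarrow> (u - p)\<^sup>2 + (v - q)\<^sup>2 = s\<^sup>2"
proof -
  have "(u, v) \<in> sphere (p, q) s \<longleftrightarrow> dist (p, q) (u, v) ^ 2 = s\<^sup>2"
    using assms by (simp add: power2_eq_iff_nonneg)
  then show ?thesis
    by (simp add: dist_prod_def dist_real_def power2_commute)
qed

text \<open>For another common point \<open>q = p + d\<close>, the two sphere equations become
  \<open>d \<bullet> d + 2 * m * (d \<bullet> u) = 0\<close> and the same with \<open>n\<close>. As
  \<open>m \<noteq> n\<close>, their difference kills \<open>d \<bullet> u\<close>, and then
  \<open>d = 0\<close>. Because \<open>m\<close> and \<open>n\<close> are signed, external and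
  internal contact are handled together.\<close>

lemma sphere_Int_sphere_singleton:
  fixes p z w u :: "'a::real_inner"
  assumes "p \<in> sphere z r" "p \<in> sphere w s"
    and "p - z = m *\<^sub>R u" "p - w = n *\<^sub>R u" "m \<noteq> n"
  shows "sphere z r \<inter> sphere w s = {p}"
proof -
  have "q = p" if q: "q \<in> sphere z r" "q \<in> sphere w s" for q
  proof -
    define d where "d = q - p"
    have expand: "(norm (d + e))\<^sup>2 = d \<bullet> d + 2 * (d \<bullet> e) + (norm e)\<^sup>2" for e
      by (simp add: power2_norm_eq_inner inner_add_left inner_add_right inner_commute)
    have "norm (d + m *\<^sub>R u) = norm (m *\<^sub>R u)" "norm (d + n *\<^sub>R u) = norm (n *\<^sub>R u)"
      using assms(1,2) q unfolding d_def assms(3,4)[symmetric]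
      by (simp_all add: dist_norm norm_minus_commute)
    then have "d \<bullet> d + 2 * m * (d \<bullet> u) = 0" "d \<bullet> d + 2 * n * (d \<bullet> u) = 0"
      using expand[of "m *\<^sub>R u"] expand[of "n *\<^sub>R u"] by auto
    moreover from this have "2 * (m - n) * (d \<bullet> u) = 0"
      by (simp only: left_diff_distrib right_diff_distrib)
    ultimately have "d \<bullet> d = 0"
      using \<open>m \<noteq> n\<close> by auto
    then show "q = p"
      by (simp add: d_def)
  qed
  then show ?thesis
    using assms(1,2) by blast
qed

text \<open>The four points of the first circle in the axis directions suffice: subtracting the
  equations of two opposite ones cancels \<open>s\<close> and leaves \<open>4 * r\<close> times a
  coordinate difference of the centres.\<close>

lemma sphere_eq_imp:
  fixes z w :: point
  assumes "r > 0" "sphere z r = sphere w s"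
  shows "z = w \<and> r = s"
proof -
  obtain z1 z2 w1 w2 where zw: "z = (z1, z2)" "w = (w1, w2)"
    by (meson surj_pair)
  have "(z1 + r, z2) \<in> sphere z r" "(z1 - r, z2) \<in> sphere z r"
    "(z1, z2 + r) \<in> sphere z r" "(z1, z2 - r) \<in> sphere z r"
    using assms(1) by (simp_all add: zw mem_sphere_pair_iff del: mem_sphere)
  then have mem: "(z1 + r, z2) \<in> sphere w s" "(z1 - r, z2) \<in> sphere w s"
    "(z1, z2 + r) \<in> sphere w s" "(z1, z2 - r) \<in> sphere w s"
    using assms(2) by auto
  \<comment> \<open>A sphere of negative radius is empty, so the points just found force the sign of
    \<open>s\<close>.\<close>
  then have s: "s \<ge> 0"
    by (auto simp: sphere_def)
  have eqs: "(z1 + r - w1)\<^sup>2 + (z2 - w2)\<^sup>2 = s\<^sup>2" "(z1 - r - w1)\<^sup>2 + (z2 - w2)\<^sup>2 = s\<^sup>2"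
    "(z1 - w1)\<^sup>2 + (z2 + r - w2)\<^sup>2 = s\<^sup>2" "(z1 - w1)\<^sup>2 + (z2 - r - w2)\<^sup>2 = s\<^sup>2"
    using mem s by (simp_all add: zw mem_sphere_pair_iff del: mem_sphere)
  have "4 * r * (z1 - w1) = 0" "4 * r * (z2 - w2) = 0"
    using eqs by (algebra+)
  then have "z1 = w1" "z2 = w2"
    using assms(1) by auto
  moreover from this have "r\<^sup>2 = s\<^sup>2"
    using eqs(1) by simp
  ultimately show ?thesis
    using assms(1) s zw by (simp add: power2_eq_iff_nonneg)
qed

section \<open>Circles as point sets, and orthogonality of two circles\<close>

lemma is_circle_sphere:
  assumes "r > 0"
  shows "is_circle (sphere z r)"
  using assms unfolding is_circle_def by blast

lemma circle_neq_singleton: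
  assumes "is_circle S"
  shows "S \<noteq> {p}"
proof
  assume "S = {p}"
  then obtain z r where r: "r > 0" "{p} = sphere z r"
    using assms unfolding is_circle_def by blast
  obtain z1 z2 where z: "z = (z1, z2)"
    by fastforce
  have "(z1 + r, z2) \<in> sphere z r" "(z1 - r, z2) \<in> sphere z r"
    using r(1) by (simp_all add: z mem_sphere_pair_iff del: mem_sphere)
  then have "(z1 + r, z2) = p" "(z1 - r, z2) = p"
    unfolding r(2)[symmetric] by simp_all
  then show False
    using r(1) by auto
qed

lemma circle_Int_singleton_imp_neq:
  assumes "is_circle S" "S \<inter> T = {p}"
  shows "S \<noteq> T"
  using assms circle_neq_singleton[of S p] by (metis Int_absorb)

text \<open>At a common point the tangent lines are perpendicular exactly when the radii are, and
  the law of cosines turns this into the Pythagorean equation for the centres. That equation does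
  not mention the point, so it decides for all common points at once.\<close>

lemma orthogonal_circles_sphere_iff:
  assumes "r > 0" "s > 0"
  shows "orthogonal_circles (sphere z r) (sphere w s) \<longleftrightarrow>
    sphere z r \<inter> sphere w s \<noteq> {} \<and> (dist z w)\<^sup>2 = r\<^sup>2 + s\<^sup>2"
proof -
  have cosine: "(dist z w)\<^sup>2 = r\<^sup>2 + s\<^sup>2 - 2 * ((p - z) \<bullet> (p - w))"
    if "p \<in> sphere z r \<inter> sphere w s" for p
  proof -
    have "norm (p - z) = r" "norm (p - w) = s"
      using that by (auto simp: dist_norm norm_minus_commute)
    moreover have "norm ((p - z) - (p - w)) = dist z w"
      by (simp add: dist_norm norm_minus_commute)
    ultimately show ?thesis
      using dot_norm_neg[of "p - z" "p - w"] by simp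
  qed
  have tangents: "(\<forall>u\<in>tangent_line z p. \<forall>v\<in>tangent_line w p. orthogonal (u - p) (v - p)) \<longleftrightarrow>
      (p - z) \<bullet> (p - w) = 0" (is "?L \<longleftrightarrow> _") if p: "p \<in> sphere z r \<inter> sphere w s" for p
  proof -
    obtain m1 m2 n1 n2 where mn: "p - z = (m1, m2)" "p - w = (n1, n2)"
      by (meson surj_pair)
    have nonzero: "p - z \<noteq> 0" "p - w \<noteq> 0"
      using p assms by auto
    show ?thesis
    proof
      assume L: ?L
      \<comment> \<open>Quarter turns of the two radius vectors give direction vectors of the two
        tangent lines.\<close>
      have "p + (- m2, m1) \<in> tangent_line z p" "p + (- n2, n1) \<in> tangent_line w p"
        by (simp_all add: tangent_line_def mn orthogonal_def)
      from L[rule_format, OF this] show "(p - z) \<bullet> (p - w) = 0"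
        by (simp add: mn orthogonal_def algebra_simps)
    next
      assume perp: "(p - z) \<bullet> (p - w) = 0"
      show ?L
      proof (intro ballI)
        fix u v
        assume uv: "u \<in> tangent_line z p" "v \<in> tangent_line w p"
        obtain u1 u2 v1 v2 where c: "u - p = (u1, u2)" "v - p = (v1, v2)"
          by (meson surj_pair)
        have e: "u1 * m1 + u2 * m2 = 0" "v1 * n1 + v2 * n2 = 0" "m1 * n1 + m2 * n2 = 0"
          using uv perp by (simp_all add: tangent_line_def c mn orthogonal_def)
        \<comment> \<open>In the plane \<open>u - p\<close> and \<open>v - p\<close> are multiples
          of the quarter turns of the radius vectors, so their inner product is a multiple of that
          of the radii. Multiplying by the squared lengths of the radii avoids naming the
          factors.\<close>
        have "(m1\<^sup>2 + m2\<^sup>2) * (n1\<^sup>2 + n2\<^sup>2) * (u1 * v1 + u2 * v2) = 0"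
          using e by algebra
        moreover have "m1\<^sup>2 + m2\<^sup>2 \<noteq> 0" "n1\<^sup>2 + n2\<^sup>2 \<noteq> 0"
          using nonzero by (auto simp: mn zero_prod_def sum_power2_eq_zero_iff)
        ultimately have "u1 * v1 + u2 * v2 = 0"
          unfolding mult_eq_0_iff by blast
        then show "orthogonal (u - p) (v - p)"
          by (simp add: c orthogonal_def)
      qed
    qed
  qed
  \<comment> \<open>A circle determines its centre and radius, so the existentially quantified ones
    in the definition are the given ones.\<close>
  have "orthogonal_circles (sphere z r) (sphere w s) \<longleftrightarrow>
      sphere z r \<inter> sphere w s \<noteq> {} \<and> (\<forall>p\<in>sphere z r \<inter> sphere w s.
        \<forall>u\<in>tangent_line z p. \<forall>v\<in>tangent_line w p. orthogonal (u - p) (v - p))"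
    using assms sphere_eq_imp unfolding orthogonal_circles_def by metis
  also have "\<dots> \<longleftrightarrow> sphere z r \<inter> sphere w s \<noteq> {} \<and>
      (\<forall>p\<in>sphere z r \<inter> sphere w s. (dist z w)\<^sup>2 = r\<^sup>2 + s\<^sup>2)"
    using tangents cosine by simp
  also have "\<dots> \<longleftrightarrow> sphere z r \<inter> sphere w s \<noteq> {} \<and> (dist z w)\<^sup>2 = r\<^sup>2 + s\<^sup>2"
    by blast
  finally show ?thesis .
qed

section \<open>Contact points and Beecroft duals of arbitrary systems\<close>

lemma tangency_points_pairwise:
  assumes "\<And>S. S \<in> \<Omega> \<Longrightarrow> is_circle S" "pairwise tangent_circles \<Omega>"
  shows "tangency_points \<Omega> = {p. \<exists>S\<in>\<Omega>. \<exists>T\<in>\<Omega>. S \<noteq> T \<and> S \<inter> T = {p}}"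
proof -
  \<comment> \<open>No circle meets itself in a single point, so within a pairwise tangent system
    tangency amounts to being distinct.\<close>
  have iff: "tangent_circles S T \<and> S \<inter> T = {p} \<longleftrightarrow> S \<noteq> T \<and> S \<inter> T = {p}"
    if "S \<in> \<Omega>" "T \<in> \<Omega>" for S T p
  proof (cases "S = T")
    case True
    then show ?thesis
      using circle_neq_singleton[OF assms(1)[OF that(1)], of p] by simp
  next
    case False
    then show ?thesis
      using pairwiseD[OF assms(2) that] by simp
  qed
  show ?thesis
    unfolding tangency_points_def by (intro Collect_cong bex_cong refl iff)
qed

text \<open>A triple in a four-element system is the same as its omitted circle, so the assignment
  on triples may be given as a map \<open>g\<close> on the circles themselves; composing
  \<open>g\<close> with the inverse of \<open>K \<mapsto> \<alpha> - {K}\<close> yields the required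
  bijection.\<close>

lemma is_beecroft_dualI:
  assumes "four_tangent_circles \<alpha>" "card (tangency_points \<alpha>) = 6" "bij_betw g \<alpha> \<beta>"
    and g: "\<And>K. K \<in> \<alpha> \<Longrightarrow> is_circle (g K) \<and> tangency_points (\<alpha> - {K}) \<subseteq> g K"
  shows "is_beecroft_dual \<beta> \<alpha>"
proof -
  have card4: "card \<alpha> = 4"
    using assms(1) by (simp add: four_tangent_circles_def)
  then have fin: "finite \<alpha>"
    using card.infinite by fastforce
  define h where "h = (\<lambda>K. \<alpha> - {K})"
  have triples: "\<exists>K\<in>\<alpha>. T = h K" if "T \<subseteq> \<alpha>" "card T = 3" for T
  proof -
    have "card (\<alpha> - T) = 1"
      using that card4 fin by (simp add: card_Diff_subset finite_subset)
    then obtain K where "\<alpha> - T = {K}"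
      by (auto simp: card_1_singleton_iff)
    then show ?thesis
      using that by (auto simp: h_def)
  qed
  have "h ` \<alpha> \<subseteq> {T. T \<subseteq> \<alpha> \<and> card T = 3}"
    using card4 fin by (auto simp: h_def)
  then have "h ` \<alpha> = {T. T \<subseteq> \<alpha> \<and> card T = 3}"
    using triples by blast
  moreover have inj: "inj_on h \<alpha>"
    by (auto simp: inj_on_def h_def)
  ultimately have h: "bij_betw h \<alpha> {T. T \<subseteq> \<alpha> \<and> card T = 3}"
    by (simp add: bij_betw_def)
  define f where "f = g \<circ> inv_into \<alpha> h"
  have "bij_betw f {T. T \<subseteq> \<alpha> \<and> card T = 3} \<beta>"
    unfolding f_def using bij_betw_inv_into[OF h] assms(3) by (rule bij_betw_trans)
  moreover have "is_circle (f T) \<and> tangency_points T \<subseteq> f T" if T: "T \<subseteq> \<alpha>" "card T = 3" for T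
  proof -
    obtain K where K: "K \<in> \<alpha>" "T = h K"
      using triples[OF T] by blast
    then have "inv_into \<alpha> h T = K"
      using inj by simp
    then show ?thesis
      using g[OF K(1)] K(2) by (simp add: f_def) (simp add: h_def)
  qed
  ultimately show ?thesis
    using assms(1,2) unfolding is_beecroft_dual_def by blast
qed

text \<open>Tangency and duality are reduced to six intersections and twelve incidences. Each
  \<open>l\<close> circle belongs to the triple that omits the \<open>k\<close> circle with the same
  index. No reflection enters, so the lemma serves both directions of the duality.\<close>

lemma four_circles_with_dual:
  assumes circles: "is_circle k1" "is_circle k2" "is_circle k3" "is_circle k4"
    and points: "k1 \<inter> k2 = {p12}" "k1 \<inter> k3 = {p13}" "k1 \<inter> k4 = {p14}"
      "k2 \<inter> k3 = {p23}" "k2 \<inter> k4 = {p24}" "k3 \<inter> k4 = {p34}"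
    and dist: "distinct [p12, p13, p14, p23, p24, p34]"
    and dual_circles: "is_circle l1" "is_circle l2" "is_circle l3" "is_circle l4"
    and dual_distinct: "distinct [l1, l2, l3, l4]"
    and dual_points: "{p23, p24, p34} \<subseteq> l1" "{p13, p14, p34} \<subseteq> l2"
      "{p12, p14, p24} \<subseteq> l3" "{p12, p13, p23} \<subseteq> l4"
  shows "four_tangent_circles {k1, k2, k3, k4}"
    and "tangency_points {k1, k2, k3, k4} = {p12, p13, p14, p23, p24, p34}"
    and "is_beecroft_dual {l1, l2, l3, l4} {k1, k2, k3, k4}"
proof -
  have neq: "distinct [k1, k2, k3, k4]"
    using points[THEN circle_Int_singleton_imp_neq[rotated]] circles by simp
  have pw: "pairwise tangent_circles {k1, k2, k3, k4}"
    using circles points by (auto simp: pairwise_def tangent_circles_def Int_commute)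
  show four: "four_tangent_circles {k1, k2, k3, k4}"
    using neq circles pw by (auto simp: four_tangent_circles_def)
  have points': "k2 \<inter> k1 = {p12}" "k3 \<inter> k1 = {p13}" "k4 \<inter> k1 = {p14}"
      "k3 \<inter> k2 = {p23}" "k4 \<inter> k2 = {p24}" "k4 \<inter> k3 = {p34}"
    using points by blast+
  have tp: "tangency_points \<Omega> = {p. \<exists>S\<in>\<Omega>. \<exists>T\<in>\<Omega>. S \<noteq> T \<and> S \<inter> T = {p}}"
    if "\<Omega> \<subseteq> {k1, k2, k3, k4}" for \<Omega>
    using that circles pairwise_subset[OF pw that] by (intro tangency_points_pairwise) auto
  have triple: "tangency_points {S, T, U} \<subseteq> {p, q, s}"
    if "{S, T, U} \<subseteq> {k1, k2, k3, k4}" "S \<inter> T = {p}" "S \<inter> U = {q}" "T \<inter> U = {s}" for S T U p q s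
    using that(2-4) Int_commute[of S T] Int_commute[of S U] Int_commute[of T U]
    unfolding tp[OF that(1)] by auto
  show all: "tangency_points {k1, k2, k3, k4} = {p12, p13, p14, p23, p24, p34}"
    using neq by (subst tp) (auto simp: points points')
  define g where "g = (\<lambda>K. if K = k1 then l1 else if K = k2 then l2 else if K = k3 then l3 else l4)"
  have g: "g k1 = l1" "g k2 = l2" "g k3 = l3" "g k4 = l4"
    using neq by (auto simp: g_def)
  have diffs: "{k1, k2, k3, k4} - {k1} = {k2, k3, k4}" "{k1, k2, k3, k4} - {k2} = {k1, k3, k4}"
    "{k1, k2, k3, k4} - {k3} = {k1, k2, k4}" "{k1, k2, k3, k4} - {k4} = {k1, k2, k3}"
    using neq by auto
  have t: "tangency_points {k2, k3, k4} \<subseteq> l1" "tangency_points {k1, k3, k4} \<subseteq> l2"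
    "tangency_points {k1, k2, k4} \<subseteq> l3" "tangency_points {k1, k2, k3} \<subseteq> l4"
    using triple[OF _ points(4,5,6)] triple[OF _ points(2,3,6)] triple[OF _ points(1,3,5)]
      triple[OF _ points(1,2,4)] dual_points by blast+
  show "is_beecroft_dual {l1, l2, l3, l4} {k1, k2, k3, k4}"
  proof (rule is_beecroft_dualI[OF four, where g = g])
    show "card (tangency_points {k1, k2, k3, k4}) = 6"
      using dist unfolding all by simp
    show "bij_betw g {k1, k2, k3, k4} {l1, l2, l3, l4}"
      using dual_distinct by (auto simp: bij_betw_def g inj_on_def)
  next
    fix K assume "K \<in> {k1, k2, k3, k4}"
    then show "is_circle (g K) \<and> tangency_points ({k1, k2, k3, k4} - {K}) \<subseteq> g K"
      using dual_circles t diffs g by fastforce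
  qed
qed

theorem theorem1:
  fixes a b c r1 r2 r3 r4 :: real
    and A B C D :: point
    and K1 K2 K3 K4 \<Lambda> :: "point set"
    and \<rho> :: "point \<Rightarrow> point"
    and \<alpha> \<beta> :: "point set set"
  assumes "a > 0" and "b > 0" and "c > 0" and "a\<^sup>2 + b\<^sup>2 = c\<^sup>2"
    and "r1 = 1/2 * (a + b - c)"
    and "r2 = 1/2 * (a - b + c)"
    and "r3 = 1/2 * (- a + b + c)"
    and "r4 = 1/2 * (a + b + c)"
    and "C = (0, 0)" and "B = (a, 0)" and "A = (0, b)" and "D = (a, b)"
    and "K1 = sphere C r1" and "K2 = sphere B r2" and "K3 = sphere A r3" and "K4 = sphere D r4"
    and "\<alpha> = {K1, K2, K3, K4}"
    and "\<Lambda> = {(x, y). x + y = r1}"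
    and "\<rho> = (\<lambda>(x, y). (r1 - y, r1 - x))"
    and "\<beta> = {\<rho> ` K1, \<rho> ` K2, \<rho> ` K3, \<rho> ` K4}"
  shows "four_tangent_circles \<alpha>
    \<and> is_reflection_in \<rho> \<Lambda>
    \<and> is_beecroft_dual \<beta> \<alpha> \<and> is_beecroft_dual \<alpha> \<beta>
    \<and> card (tangency_points \<alpha>) = 6
    \<and> card (tangency_points \<alpha> \<inter> \<Lambda>) = 4
    \<and> (\<exists>p q. p \<noteq> q \<and> tangency_points \<alpha> - \<Lambda> = {p, q} \<and> symmetric_wrt \<Lambda> p q)
    \<and> tangency_points \<beta> = tangency_points \<alpha>
    \<and> (\<forall>E\<in>\<beta>. card {K \<in> \<alpha>. orthogonal_circles E K} = 3)"
proof -

  \<comment> \<open>Radii as parameters, and the reflection as an isometry\<close>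
  define r x y where "r = r1" "x = r2" "y = r3"
  have abc: "a = r + x" "b = r + y" "c = x + y" "r4 = r + x + y"
    using assms(5-8) by (simp_all add: r_x_y_def field_simps)
  have rel: "r * (r + x + y) = x * y"
    using assms(4) unfolding abc by (simp add: power2_eq_square algebra_simps)
  \<comment> \<open>The numbers \<open>a + b - c\<close>, \<open>a + c - b\<close>,
    \<open>b + c - a\<close> are twice \<open>r\<close>, \<open>x\<close>, \<open>y\<close>, so the
    strict triangle inequalities give the positivity of the radii.\<close>
  have "c < a + b" "b < a + c" "a < b + c"
  proof -
    have "a * b > 0" "a * c > 0" "b * c > 0" "a\<^sup>2 > 0" "b\<^sup>2 > 0"
      using assms(1-3) by simp_all
    then have "c\<^sup>2 < (a + b)\<^sup>2" "b\<^sup>2 < (a + c)\<^sup>2" "a\<^sup>2 < (b + c)\<^sup>2"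
      using assms(4) unfolding power2_sum mult.assoc by linarith+
    then show "c < a + b" "b < a + c" "a < b + c"
      using assms(1-3) by (auto intro: power2_less_imp_less)
  qed
  then have pos: "r > 0" "x > 0" "y > 0"
    using abc by auto
  have K: "K1 = sphere (0, 0) r" "K2 = sphere (r + x, 0) x" "K3 = sphere (0, r + y) y"
    "K4 = sphere (r + x, r + y) (r + x + y)"
    using assms(9-16) abc by (simp_all add: r_x_y_def)
  have \<rho>: "\<rho> (u, v) = (r - v, r - u)" for u v
    by (simp add: assms r_x_y_def)
  have \<Lambda>: "(u, v) \<in> \<Lambda> \<longleftrightarrow> u + v = r" for u v
    by (simp add: assms(18) r_x_y_def)
  have invol: "\<rho> (\<rho> p) = p" for p
    by (cases p) (simp add: \<rho>)
  have isom: "dist (\<rho> p) (\<rho> q) = dist p q" for p q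
    by (cases p; cases q) (simp add: \<rho> dist_prod_def dist_real_def power2_commute add.commute)
  have image_sphere: "\<rho> ` sphere z s = sphere (\<rho> z) s" for z s
  proof -
    have "p \<in> \<rho> ` sphere z s" if "p \<in> sphere (\<rho> z) s" for p
      using that isom[of z "\<rho> p"] by (intro image_eqI[of _ _ "\<rho> p"]) (simp_all add: invol)
    then show ?thesis
      by (auto simp: isom)
  qed
  have \<rho>K: "\<rho> ` K1 = sphere (r, r) r" "\<rho> ` K2 = sphere (r, - x) x" "\<rho> ` K3 = sphere (- y, r) y"
    "\<rho> ` K4 = sphere (- y, - x) (r + x + y)"
    by (simp_all add: K image_sphere \<rho>)

  \<comment> \<open>Coordinates of the six contact points\<close>
  define p12 p13 p24 p34 where "p12 = (r, 0::real)" "p13 = (0::real, r)"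
    "p24 = (r + x, - x)" "p34 = (- y, r + y)"
  note side_defs = p12_p13_p24_p34_def
  \<comment> \<open>\<open>(u, v)\<close> is \<open>(a / c, b / c)\<close>, the unit vector from
    \<open>C\<close> towards \<open>D\<close>; \<open>(- u, v)\<close> is the one from
    \<open>B\<close> towards \<open>A\<close>.\<close>
  define u v where "u = (r + x) / (x + y)" "v = (r + y) / (x + y)"
  \<comment> \<open>\<open>p14\<close> lies beyond \<open>C\<close> as seen from \<open>D\<close>,
    at distance \<open>r1\<close>, because \<open>K4\<close> encloses \<open>K1\<close>.
    \<open>p23\<close> divides the segment from \<open>B\<close> to \<open>A\<close> into lengths
    \<open>r2\<close> and \<open>r3\<close>.\<close>
  define p14 p23 where "p14 = (- (r * u), - (r * v))" "p23 = (y * u, x * v)"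
  note diag = p14_p23_def
  have \<rho>_side: "\<rho> p12 = p12" "\<rho> p13 = p13" "\<rho> p24 = p24" "\<rho> p34 = p34"
    by (simp_all add: side_defs \<rho>)
  \<comment> \<open>After clearing denominators both coordinates reduce to
    \<open>r * (r + x + y) = x * y\<close>.\<close>
  have \<rho>_14: "\<rho> p14 = p23"
    using pos rel by (simp add: diag u_v_def \<rho> field_simps)
  then have \<rho>_23: "\<rho> p23 = p14"
    using invol by metis
  have uv: "u\<^sup>2 + v\<^sup>2 = 1"
  proof -
    have "(r + x)\<^sup>2 + (r + y)\<^sup>2 = (x + y)\<^sup>2"
      using assms(4) unfolding abc .
    then show ?thesis
      using pos by (simp add: u_v_def power_divide flip: add_divide_distrib)
  qed
  have side_mem: "p12 \<in> K1" "p12 \<in> K2" "p13 \<in> K1" "p13 \<in> K3" "p24 \<in> K2" "p24 \<in> K4" "p34 \<in> K3" "p34 \<in> K4"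
    using pos by (auto simp: K side_defs mem_sphere_pair_iff power2_eq_square algebra_simps simp del: mem_sphere)
  \<comment> \<open>With the legs written through the hypotenuse and \<open>(u, v)\<close>, the
    vectors from centres to contact points below become polynomial identities.\<close>
  have legs: "r + x = (x + y) * u" "r + y = (x + y) * v"
    using pos by (simp_all add: u_v_def)
  have diag_sub: "p14 - (0, 0) = (- r) *\<^sub>R (u, v)"
    "p14 - (r + x, r + y) = (- (r + x + y)) *\<^sub>R (u, v)"
    "p23 - (r + x, 0) = x *\<^sub>R (- u, v)"
    "p23 - (0, r + y) = (- y) *\<^sub>R (- u, v)"
    unfolding diag diff_Pair scaleR_Pair real_scaleR_def
    by (simp_all only: prod.inject, safe) (use legs in algebra)+
  have mem_sphereI: "p \<in> sphere z s" if "p - z = m *\<^sub>R w" "norm w = 1" "\<bar>m\<bar> = s"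
    for p z w :: point and m s
    using that by (metis dist_norm mem_sphere mult.right_neutral norm_minus_commute norm_scaleR)
  have unit: "norm (u, v) = 1" "norm (- u, v) = 1"
    using uv by (simp_all add: norm_prod_def)
  have diag_mem: "p14 \<in> K1" "p14 \<in> K4" "p23 \<in> K2" "p23 \<in> K3"
    using mem_sphereI[OF diag_sub(1) unit(1)] mem_sphereI[OF diag_sub(2) unit(1)]
      mem_sphereI[OF diag_sub(3) unit(2)] mem_sphereI[OF diag_sub(4) unit(2)] pos
    unfolding K by (simp_all add: algebra_simps del: mem_sphere)

  \<comment> \<open>Pairwise intersections in the two systems\<close>
  have Int: "K1 \<inter> K2 = {p12}" "K1 \<inter> K3 = {p13}" "K1 \<inter> K4 = {p14}"
    "K2 \<inter> K3 = {p23}" "K2 \<inter> K4 = {p24}" "K3 \<inter> K4 = {p34}"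
  proof -
    \<comment> \<open>In each case \<open>u\<close> is a direction of the line of centres, and
      \<open>m\<close>, \<open>n\<close> are the radii up to sign: opposite signs for external
      contact, equal signs for contact with the enclosing \<open>K4\<close>.\<close>
    show "K1 \<inter> K2 = {p12}"
      using side_mem pos unfolding K
      by (intro sphere_Int_sphere_singleton[where m = r and n = "- x" and u = "(1, 0)"])
        (simp_all add: side_defs)
    show "K1 \<inter> K3 = {p13}"
      using side_mem pos unfolding K
      by (intro sphere_Int_sphere_singleton[where m = r and n = "- y" and u = "(0, 1)"])
        (simp_all add: side_defs)
    show "K2 \<inter> K4 = {p24}"
      using side_mem pos unfolding K
      by (intro sphere_Int_sphere_singleton[where m = x and n = "r + x + y" and u = "(0, - 1)"])
        (simp_all add: side_defs)
    show "K3 \<inter> K4 = {p34}"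
      using side_mem pos unfolding K
      by (intro sphere_Int_sphere_singleton[where m = y and n = "r + x + y" and u = "(- 1, 0)"])
        (simp_all add: side_defs)
    show "K1 \<inter> K4 = {p14}"
      using diag_mem(1,2) pos unfolding K
      by (intro sphere_Int_sphere_singleton[OF _ _ diag_sub(1,2)]) auto
    show "K2 \<inter> K3 = {p23}"
      using diag_mem(3,4) pos unfolding K
      by (intro sphere_Int_sphere_singleton[OF _ _ diag_sub(3,4)]) auto
  qed
  have inj: "inj \<rho>"
    by (metis injI invol)
  \<comment> \<open>\<open>\<rho>\<close> fixes the four side points and swaps \<open>p14\<close>
    with \<open>p23\<close>, so only these two change places.\<close>
  have \<rho>Int: "\<rho> ` K1 \<inter> \<rho> ` K2 = {p12}" "\<rho> ` K1 \<inter> \<rho> ` K3 = {p13}" "\<rho> ` K1 \<inter> \<rho> ` K4 = {p23}"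
    "\<rho> ` K2 \<inter> \<rho> ` K3 = {p14}" "\<rho> ` K2 \<inter> \<rho> ` K4 = {p24}" "\<rho> ` K3 \<inter> \<rho> ` K4 = {p34}"
    by (simp_all add: image_Int[OF inj, symmetric] Int \<rho>_side \<rho>_14 \<rho>_23)

  \<comment> \<open>Distinctness of the contact points, and duality in both directions\<close>
  have uv_pos: "u > 0" "v > 0"
    using pos by (simp_all add: u_v_def)
  have on_line: "p12 \<in> \<Lambda>" "p13 \<in> \<Lambda>" "p24 \<in> \<Lambda>" "p34 \<in> \<Lambda>"
    by (simp_all add: side_defs \<Lambda>)
  have fixed: "\<rho> p = p \<longleftrightarrow> p \<in> \<Lambda>" for p
    by (cases p) (auto simp: \<rho> \<Lambda>)
  have "fst p14 < 0" "fst p23 > 0"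
    using pos uv_pos by (simp_all add: diag)
  then have diag_neq: "p14 \<noteq> p23"
    by auto
  \<comment> \<open>\<open>\<Lambda>\<close> is the fixed-point set of \<open>\<rho>\<close>, and
    both points are moved.\<close>
  then have off_line: "p14 \<notin> \<Lambda>" "p23 \<notin> \<Lambda>"
    using \<rho>_14 \<rho>_23 fixed by metis+
  have dist: "distinct [p12, p13, p14, p23, p24, p34]" "distinct [p12, p13, p23, p14, p24, p34]"
  proof -
    have "distinct [p12, p13, p24, p34]"
      using pos by (simp add: side_defs)
    then show "distinct [p12, p13, p14, p23, p24, p34]" "distinct [p12, p13, p23, p14, p24, p34]"
      using on_line off_line diag_neq by auto
  qed
  have circles: "is_circle K1" "is_circle K2" "is_circle K3" "is_circle K4"
    "is_circle (\<rho> ` K1)" "is_circle (\<rho> ` K2)" "is_circle (\<rho> ` K3)" "is_circle (\<rho> ` K4)"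
    unfolding \<rho>K unfolding K using pos by (simp_all add: is_circle_sphere)
  have side_dual: "p12 \<in> \<rho> ` K1" "p12 \<in> \<rho> ` K2" "p13 \<in> \<rho> ` K1" "p13 \<in> \<rho> ` K3"
    "p24 \<in> \<rho> ` K2" "p24 \<in> \<rho> ` K4" "p34 \<in> \<rho> ` K3" "p34 \<in> \<rho> ` K4"
    and diag_dual: "p23 \<in> \<rho> ` K1" "p23 \<in> \<rho> ` K4" "p14 \<in> \<rho> ` K2" "p14 \<in> \<rho> ` K3"
    using \<rho>Int by blast+
  have K_neq: "distinct [K1, K2, K3, K4]"
    using Int[THEN circle_Int_singleton_imp_neq[rotated]] circles by simp
  then have \<alpha>_neq: "distinct [K4, K3, K2, K1]"
    by (simp add: eq_commute)
  then have \<beta>_neq: "distinct [\<rho> ` K4, \<rho> ` K3, \<rho> ` K2, \<rho> ` K1]"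
    using inj by (simp add: inj_image_eq_iff)
  \<comment> \<open>The reversed order assigns to the triple omitting the \<open>i\<close>-th circle
    the mirror image of the \<open>(5 - i)\<close>-th one.\<close>
  note \<alpha>_facts = four_circles_with_dual[OF circles(1-4) Int dist(1) circles(8,7,6,5) \<beta>_neq]
  note \<beta>_facts = four_circles_with_dual[OF circles(5-8) \<rho>Int dist(2) circles(4,3,2,1) \<alpha>_neq]
  have \<alpha>: "four_tangent_circles \<alpha>" "tangency_points \<alpha> = {p12, p13, p14, p23, p24, p34}"
      "is_beecroft_dual \<beta> \<alpha>"
    using \<alpha>_facts side_dual diag_dual
    by (simp_all add: assms(17,20) insert_commute)
  have \<beta>: "tangency_points \<beta> = {p12, p13, p23, p14, p24, p34}" "is_beecroft_dual \<alpha> \<beta>"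
    using \<beta>_facts(2,3) side_mem diag_mem
    by (simp_all add: assms(17,20) insert_commute)

  \<comment> \<open>The reflection line and the position of the contact points\<close>
  have reflection: "is_reflection_in \<rho> \<Lambda>"
  proof -
    have bisector: "dist q p = dist q (\<rho> p) \<longleftrightarrow> q \<in> \<Lambda>" if "p \<notin> \<Lambda>" for p q
    proof -
      obtain p1 p2 q1 q2 where pq: "p = (p1, p2)" "q = (q1, q2)"
        by (meson surj_pair)
      have "dist q p = dist q (\<rho> p) \<longleftrightarrow> (dist q p)\<^sup>2 = (dist q (\<rho> p))\<^sup>2"
        by (simp add: power2_eq_iff_nonneg)
      also have "\<dots> \<longleftrightarrow> (q1 - p1)\<^sup>2 + (q2 - p2)\<^sup>2 = (q1 - (r - p2))\<^sup>2 + (q2 - (r - p1))\<^sup>2"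
        by (simp add: pq \<rho> dist_prod_def dist_real_def)
      \<comment> \<open>The two sides differ by twice this product, whose first factor is nonzero
        because \<open>p\<close> is off \<open>\<Lambda>\<close>.\<close>
      also have "\<dots> \<longleftrightarrow> (r - p1 - p2) * (q1 + q2 - r) = 0"
        by (auto simp: power2_eq_square algebra_simps)
      also have "\<dots> \<longleftrightarrow> q \<in> \<Lambda>"
        using that by (auto simp: pq \<Lambda>)
      finally show ?thesis .
    qed
    have "symmetric_wrt \<Lambda> p (\<rho> p)" for p
    proof (cases "p \<in> \<Lambda>")
      case True
      then show ?thesis
        using fixed[of p] by (simp add: symmetric_wrt_def)
    next
      case False
      then have "p \<noteq> \<rho> p"
        using fixed[of p] by auto
      then show ?thesis
        using bisector[OF False] by (simp add: symmetric_wrt_def)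
    qed
    then show ?thesis
      by (simp add: is_reflection_in_def)
  qed
  have six: "card (tangency_points \<alpha>) = 6"
    using dist(1) unfolding \<alpha>(2) by simp
  have "tangency_points \<alpha> \<inter> \<Lambda> = {p12, p13, p24, p34}"
    using on_line off_line unfolding \<alpha>(2) by auto
  then have four: "card (tangency_points \<alpha> \<inter> \<Lambda>) = 4"
    using dist(1) by simp
  have "tangency_points \<alpha> - \<Lambda> = {p14, p23}"
    using on_line off_line unfolding \<alpha>(2) by auto
  moreover have "symmetric_wrt \<Lambda> p14 p23"
    using reflection \<rho>_14 unfolding is_reflection_in_def by metis
  ultimately have two: "\<exists>p q. p \<noteq> q \<and> tangency_points \<alpha> - \<Lambda> = {p, q} \<and> symmetric_wrt \<Lambda> p q"
    using diag_neq by blast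

  \<comment> \<open>Orthogonality between the circles of the two systems\<close>
  have meet: "\<rho> ` K1 \<inter> K1 \<noteq> {}" "\<rho> ` K1 \<inter> K2 \<noteq> {}" "\<rho> ` K1 \<inter> K3 \<noteq> {}"
    "\<rho> ` K2 \<inter> K1 \<noteq> {}" "\<rho> ` K2 \<inter> K2 \<noteq> {}" "\<rho> ` K2 \<inter> K4 \<noteq> {}"
    "\<rho> ` K3 \<inter> K1 \<noteq> {}" "\<rho> ` K3 \<inter> K3 \<noteq> {}" "\<rho> ` K3 \<inter> K4 \<noteq> {}"
    "\<rho> ` K4 \<inter> K2 \<noteq> {}" "\<rho> ` K4 \<inter> K3 \<noteq> {}" "\<rho> ` K4 \<inter> K4 \<noteq> {}"
    \<comment> \<open>The contact points on \<open>\<Lambda>\<close> supply a common point for each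
      of the twelve pairs.\<close>
    using side_mem side_dual by blast+
  have orth_iff: "orthogonal_circles (sphere (p, q) s) (sphere (p', q') s') \<longleftrightarrow>
      sphere (p, q) s \<inter> sphere (p', q') s' \<noteq> {} \<and> (p - p')\<^sup>2 + (q - q')\<^sup>2 = s\<^sup>2 + s'\<^sup>2"
    if "s > 0" "s' > 0" for p q s p' q' s' :: real
    using that by (simp add: orthogonal_circles_sphere_iff dist_prod_def dist_real_def)
  \<comment> \<open>For each pair the coordinate differences of the centres are, up to sign and
    order, the two radii.\<close>
  have orth: "orthogonal_circles (\<rho> ` K1) K1" "orthogonal_circles (\<rho> ` K1) K2" "orthogonal_circles (\<rho> ` K1) K3"
    "orthogonal_circles (\<rho> ` K2) K1" "orthogonal_circles (\<rho> ` K2) K2" "orthogonal_circles (\<rho> ` K2) K4"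
    "orthogonal_circles (\<rho> ` K3) K1" "orthogonal_circles (\<rho> ` K3) K3" "orthogonal_circles (\<rho> ` K3) K4"
    "orthogonal_circles (\<rho> ` K4) K2" "orthogonal_circles (\<rho> ` K4) K3" "orthogonal_circles (\<rho> ` K4) K4"
    using meet rel pos unfolding \<rho>K unfolding K
    by (subst orth_iff; simp add: power2_eq_square algebra_simps)+
  have not_orth: "\<not> orthogonal_circles (\<rho> ` K1) K4" "\<not> orthogonal_circles (\<rho> ` K2) K3"
    "\<not> orthogonal_circles (\<rho> ` K3) K2" "\<not> orthogonal_circles (\<rho> ` K4) K1"
  proof -
    \<comment> \<open>For the one remaining partner the squared distance of centres misses the sum
      of the squared radii: it is too small for the pairs from \<open>K1\<close> and
      \<open>K4\<close>, too large for those from \<open>K2\<close> and \<open>K3\<close>.\<close>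
    have "(r - (r + x))\<^sup>2 + (r - (r + y))\<^sup>2 < r\<^sup>2 + (r + x + y)\<^sup>2"
      "(r - 0)\<^sup>2 + (- x - (r + y))\<^sup>2 > x\<^sup>2 + y\<^sup>2"
      "(- y - (r + x))\<^sup>2 + (r - 0)\<^sup>2 > y\<^sup>2 + x\<^sup>2"
      "(- y - 0)\<^sup>2 + (- x - 0)\<^sup>2 < (r + x + y)\<^sup>2 + r\<^sup>2"
      using pos by (simp_all add: power2_eq_square algebra_simps add_pos_pos)
    then show "\<not> orthogonal_circles (\<rho> ` K1) K4" "\<not> orthogonal_circles (\<rho> ` K2) K3"
      "\<not> orthogonal_circles (\<rho> ` K3) K2" "\<not> orthogonal_circles (\<rho> ` K4) K1"
      unfolding \<rho>K unfolding K using pos by (simp_all add: orth_iff del: diff_0 diff_0_right)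
  qed
  have orth_sets: "{K \<in> \<alpha>. orthogonal_circles (\<rho> ` K1) K} = {K1, K2, K3}"
    "{K \<in> \<alpha>. orthogonal_circles (\<rho> ` K2) K} = {K1, K2, K4}"
    "{K \<in> \<alpha>. orthogonal_circles (\<rho> ` K3) K} = {K1, K3, K4}"
    "{K \<in> \<alpha>. orthogonal_circles (\<rho> ` K4) K} = {K2, K3, K4}"
    using orth not_orth by (auto simp: assms(17))
  have "card {K1, K2, K3} = 3" "card {K1, K2, K4} = 3" "card {K1, K3, K4} = 3" "card {K2, K3, K4} = 3"
    using K_neq by simp_all
  then have three: "\<forall>E\<in>\<beta>. card {K \<in> \<alpha>. orthogonal_circles E K} = 3"
    unfolding assms(20) by (simp only: ball_simps orth_sets simp_thms)
  have "tangency_points \<beta> = tangency_points \<alpha>"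
    unfolding \<alpha>(2) \<beta>(1) by (simp add: insert_commute)
  then show ?thesis
    using \<alpha>(1,3) \<beta>(2) reflection six four two three by blast
qed

end
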